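(* Let $G$ be a connected graph of order $n\geq 4$ and size $m$, and let $K_{s_1,s_2}$, with $s_1\geq s_2\geq 2$, be a maximal complete bipartite subgraph of $G$. Let $H=G\setminus K_{s_1,s_2}$ be the graph obtained from $G$ by deleting the edges of this $K_{s_1,s_2}$ (keeping all vertices), and suppose $H$ has $r$ non-trivial components $C_1,\dots,C_r$, each of which is a $c$-cyclic graph, and $p\geq 0$ trivial components. Then for every integer $k$ with $1\le k\le n$, \[ S_k(G)\leq\begin{cases} 2s_1s_2+n-p+2r(c-1)+2k, & \text{if } k\geq s_1+s_2-1,\\ s_2+ks_1+n-p+2r(c-1)+2k, & \text{if } k\leq s_1+s_2-2. \end{cases} \]
   Context: The Laplacian matrix of a graph is $L(G)=D(G)-A(G)$ ($D(G)$ the diagonal degree matrix, $A(G)$ the adjacency matrix), with eigenvalues $\mu_1\ge\dots\ge\mu_n=0$; $S_k(G)=\sum_{i=1}^k\mu_i$. A $c$-cyclic graph is a connected graph with $n'$ vertices and $n'+c-1$ edges. Trivial components are isolated vertices; non-trivial components have at least two vertices. *)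

theory Defs
  imports
    "Graph_Theory.Graph_Theory"
    "Jordan_Normal_Form.Char_Poly"
begin

text \<open>
  A finite simple graph is an object of the locale \<^locale>\<open>graph\<close>: a finite symmetric digraph
  without loops and parallel arcs. Every undirected edge is thus represented by two opposite arcs,
  which is why edges are counted as unordered pairs of end points. The connected components of such
  a graph are its strongly connected components, \<^const>\<open>pre_digraph.sccs\<close>.
\<close>

definition num_edges :: "('a, 'b) pre_digraph \<Rightarrow> nat" where
  "num_edges G = card ((\<lambda>e. {tail G e, head G e}) ` arcs G)"

definition c_cyclic :: "nat \<Rightarrow> ('a, 'b) pre_digraph \<Rightarrow> bool" where
  "c_cyclic c G \<longleftrightarrow> graph G \<and> Digraph_Component.connected G \<and>
     int (num_edges G) = int (card (verts G)) + int c - 1"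

definition maximal_complete_bipartite ::
    "nat \<Rightarrow> nat \<Rightarrow> ('a, 'b) pre_digraph \<Rightarrow> ('a, 'b) pre_digraph \<Rightarrow> bool" where
  "maximal_complete_bipartite s1 s2 K G \<longleftrightarrow>
     complete_bipartite_digraph s1 s2 K \<and>
     pre_digraph.max_subgraph G (\<lambda>K'. \<exists>a b. complete_bipartite_digraph a b K') K"

definition delete_edges :: "('a, 'b) pre_digraph \<Rightarrow> ('a, 'b) pre_digraph \<Rightarrow> ('a, 'b) pre_digraph" where
  "delete_edges G K = G\<lparr>arcs := arcs G - arcs K\<rparr>"

definition trivial_components :: "('a, 'b) pre_digraph \<Rightarrow> ('a, 'b) pre_digraph set" where
  "trivial_components G = {C \<in> pre_digraph.sccs G. card (verts C) = 1}"

definition nontrivial_components :: "('a, 'b) pre_digraph \<Rightarrow> ('a, 'b) pre_digraph set" where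
  "nontrivial_components G = {C \<in> pre_digraph.sccs G. card (verts C) \<ge> 2}"

text \<open>
  The matrices of a graph are taken with respect to an enumeration \<open>vs\<close> of its vertices.
\<close>

definition adjacency_matrix :: "('a, 'b) pre_digraph \<Rightarrow> 'a list \<Rightarrow> real mat" where
  "adjacency_matrix G vs =
     mat (length vs) (length vs) (\<lambda>(i, j). if (vs ! i, vs ! j) \<in> arcs_ends G then 1 else 0)"

definition degree_matrix :: "('a, 'b) pre_digraph \<Rightarrow> 'a list \<Rightarrow> real mat" where
  "degree_matrix G vs =
     mat (length vs) (length vs) (\<lambda>(i, j). if i = j then real (out_degree G (vs ! i)) else 0)"

definition laplacian_matrix :: "('a, 'b) pre_digraph \<Rightarrow> 'a list \<Rightarrow> real mat" where
  "laplacian_matrix G vs = degree_matrix G vs - adjacency_matrix G vs"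

text \<open>
  The real eigenvalues of a matrix with their algebraic multiplicities, in non-increasing order.
  For a real symmetric matrix, such as the Laplacian matrix of a graph, the characteristic
  polynomial splits over the reals, so that the length of this list is the order of the matrix.
\<close>

definition eigenvalue_list :: "real mat \<Rightarrow> real list" where
  "eigenvalue_list M = rev (sorted_list_of_multiset (proots (char_poly M)))"

definition laplacian_sum :: "('a, 'b) pre_digraph \<Rightarrow> 'a list \<Rightarrow> nat \<Rightarrow> real" where
  "laplacian_sum G vs k = (\<Sum>i<k. eigenvalue_list (laplacian_matrix G vs) ! i)"

end

theory Submission
  imports Defs "Jordan_Normal_Form.Schur_Decomposition"
begin

text \<open>
  The sum of the \<open>k\<close> largest Laplacian eigenvalues is the total Dirichlet energy of \<open>k\<close> orthonormal
  functions, and the energy of \<open>G\<close> is the sum of those of \<open>K\<close> and \<open>H\<close>. By Bessel's inequality an edge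
  contributes at most 2 in total. For \<open>K\<close> this gives \<open>2 s1 s2\<close>; since the top
  eigenvalue of \<open>K\<close> is \<open>s1 + s2\<close> and all others are at most \<open>s1\<close>, it also gives \<open>s2 + k s1\<close>.
  For \<open>H\<close>, cover the \<open>N\<close> non-isolated vertices by \<open>t\<close> disjoint stars, each with at least one edge:
  these have \<open>N - t\<close> edges and contribute at most \<open>N - 2 t + 2 k\<close>, and each of the remaining
  \<open>e(H) - (N - t)\<close> edges contributes at most 2. The total \<open>2 e(H) - N + 2 k\<close> does not depend on \<open>t\<close>;
  here \<open>N = n - p\<close> and \<open>e(H) = n - p + r (c - 1)\<close>.
\<close>

section \<open>Orthogonal triangularization\<close>

text \<open>Unless \<open>v\<close> is the first unit vector, a reflection exchanges the two and
  serves as \<open>W\<close>. The coordinate test \<open>v $ 0 = 1\<close> detects the exceptional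
  case, since the squared entries of \<open>v\<close> add up to 1; the identity is taken
  there.\<close>

lemma orthogonal_mat_first_col:
  fixes v :: "real vec"
  assumes v: "v \<in> carrier_vec n" and vv: "v \<bullet> v = 1" and n: "0 < n"
  obtains W where "W \<in> carrier_mat n n" "W\<^sup>T * W = 1\<^sub>m n" "col W 0 = v"
proof (cases "v $ 0 = 1")
  case True
  have "v = unit_vec n 0"
  proof (rule eq_vecI)
    fix i assume "i < dim_vec (unit_vec n 0 :: real vec)"
    then have i: "i < n" by simp
    have "(\<Sum>j<n. (v $ j)^2) = 1"
      using vv v by (simp add: scalar_prod_def power2_eq_square atLeast0LessThan)
    moreover have "(\<Sum>j<n. (v $ j)^2) = (v $ 0)^2 + (\<Sum>j\<in>{..<n}-{0}. (v $ j)^2)"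
      using n by (intro sum.remove) auto
    ultimately have "(\<Sum>j\<in>{..<n}-{0}. (v $ j)^2) = 0" using True by simp
    then have "\<forall>j\<in>{..<n}-{0}. (v $ j)^2 = 0" by (subst (asm) sum_nonneg_eq_0_iff) auto
    then show "v $ i = unit_vec n 0 $ i" using i n True by (auto simp: unit_vec_def)
  qed (use v in auto)
  then show ?thesis using n by (intro that[of "1\<^sub>m n"]) auto
next
  case False
  define w where "w j = v $ j - (if j = 0 then 1 else 0)" for j
  \<comment> \<open>This is \<open>2 / |w|^2\<close>, the factor in a Householder reflection: the
    squared length of \<open>w\<close> is \<open>2 - 2 * v $ 0\<close>, which is nonzero
    here.\<close>
  define c where "c = 1 / (1 - v $ 0)"
  \<comment> \<open>Householder reflection exchanging \<open>v\<close> and the first unit vector\<close>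
  define W where "W = mat n n (\<lambda>(i,j). (if i = j then 1 else 0) - c * w i * w j)"
  have W: "W \<in> carrier_mat n n" by (simp add: W_def)
  have sq: "(\<Sum>j<n. v $ j * v $ j) = 1"
    using vv v by (simp add: scalar_prod_def atLeast0LessThan)
  have "(\<Sum>j<n. w j * w j) = (\<Sum>j<n. v $ j * v $ j + (if j = 0 then 1 - 2 * v $ 0 else 0))"
    by (intro sum.cong) (auto simp: w_def algebra_simps)
  also have "\<dots> = 2 - 2 * v $ 0" using n by (simp add: sum.distrib sq)
  finally have ww: "(\<Sum>j<n. w j * w j) = 2 - 2 * v $ 0" .
  have cw: "c * (\<Sum>j<n. w j * w j) = 2" using False by (simp add: ww c_def field_simps)
  have "W\<^sup>T * W = 1\<^sub>m n"
  proof (rule eq_matI)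
    fix i j assume "i < dim_row (1\<^sub>m n :: real mat)" "j < dim_col (1\<^sub>m n :: real mat)"
    then have i: "i < n" and j: "j < n" by auto
    have "(W\<^sup>T * W) $$ (i,j) = (\<Sum>l<n. ((if l = i then 1 else 0) - c * w l * w i) * ((if l = j then 1 else 0) - c * w l * w j))"
      using i j by (simp add: W_def scalar_prod_def atLeast0LessThan)
    also have "\<dots> = (\<Sum>l<n. (if l = i then (if i = j then 1 else 0) - c * w i * w j else 0) - (if l = j then c * w j * w i else 0)
        + c * c * w i * w j * (w l * w l))"
      by (intro sum.cong) (auto simp: algebra_simps)
    also have "\<dots> = (if i = j then 1 else 0) - 2 * c * w i * w j + c * (c * (\<Sum>l<n. w l * w l)) * w i * w j"
      using i j by (simp add: sum.distrib sum_subtractf flip: sum_distrib_left)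
    also have "\<dots> = (if i = j then 1 else 0)" by (simp add: cw)
    finally show "(W\<^sup>T * W) $$ (i,j) = 1\<^sub>m n $$ (i,j)" using i j by simp
  qed (auto simp: W_def)
  moreover have "col W 0 = v"
  proof (rule eq_vecI)
    have "c * w 0 = -1" using False by (simp add: c_def w_def field_simps)
    moreover have "W $$ (i,0) = (if i = 0 then 1 else 0) - (c * w 0) * w i" if "i < n" for i
      using that n by (simp add: W_def algebra_simps)
    ultimately show "col W 0 $ i = v $ i" if "i < dim_vec v" for i
      using that n v W by (auto simp: w_def)
  qed (use v W in auto)
  ultimately show ?thesis using W that by blast
qed

text \<open>Deflation: conjugating by an orthogonal matrix whose first column is a unit eigenvector
  for \<open>e\<close> clears the rest of the first column, and the lower right block keeps the
  remaining linear factors. The diagonal follows the order of \<open>es\<close>, which later lets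
  the first \<open>k\<close> columns belong to the \<open>k\<close> largest eigenvalues.\<close>

lemma orthogonal_schur_form:
  fixes A :: "real mat"
  assumes "A \<in> carrier_mat n n" and "char_poly A = (\<Prod>e\<leftarrow>es. [:- e, 1:])"
  shows "\<exists>P \<in> carrier_mat n n. P\<^sup>T * P = 1\<^sub>m n \<and> diag_mat (P\<^sup>T * A * P) = es"
  using assms
proof (induction es arbitrary: n A)
  case Nil
  then have "n = 0" using degree_monic_char_poly[of A n] by simp
  then show ?case using Nil by (intro bexI[of _ "1\<^sub>m 0"]) (auto simp: diag_mat_def)
next
  case (Cons e es)
  define n1 where "n1 = n - 1"
  note A = Cons.prems(1)
  have cp: "char_poly A = [:- e, 1:] * (\<Prod>e\<leftarrow>es. [:- e, 1:])" using Cons.prems(2) by simp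
  have mon: "monic (\<Prod>e\<leftarrow>es. [:- e, 1:])" by (rule monic_prod_list) auto
  have "degree (char_poly A) = Suc (degree (\<Prod>e\<leftarrow>es. [:- e, 1:]))"
    unfolding cp using mon by (subst degree_mult_eq) auto
  then have n: "n = Suc n1" using degree_monic_char_poly[OF A] by (simp add: n1_def)
  have "eigenvalue A e" unfolding eigenvalue_root_char_poly[OF A] cp by simp
  then obtain v0 where v0: "v0 \<in> carrier_vec n" "v0 \<noteq> 0\<^sub>v n" "A *\<^sub>v v0 = e \<cdot>\<^sub>v v0"
    using A by (auto simp: eigenvalue_def eigenvector_def)
  define v where "v = (1 / sqrt (v0 \<bullet> v0)) \<cdot>\<^sub>v v0"
  have pos: "v0 \<bullet> v0 > 0"
    using conjugate_square_greater_0_vec[OF v0(1)] v0(2) by (simp add: conjugate_vec_def vec_eq_iff)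
  have v: "v \<in> carrier_vec n" "A *\<^sub>v v = e \<cdot>\<^sub>v v"
    using v0 A by (auto simp: v_def mult_mat_vec smult_smult_assoc mult.commute)
  have vv: "v \<bullet> v = 1"
    using v0(1) pos by (simp add: v_def)
  obtain W where W: "W \<in> carrier_mat n n" "W\<^sup>T * W = 1\<^sub>m n" "col W 0 = v"
    using orthogonal_mat_first_col[OF v(1) vv] n by auto
  have WW: "W * W\<^sup>T = 1\<^sub>m n" using mat_mult_left_right_inverse[OF _ W(1) W(2)] W(1) by simp
  define A' where "A' = W\<^sup>T * A * W"
  have A': "A' \<in> carrier_mat n n" using A W(1) by (simp add: A'_def)
  obtain A1 A2 A0 A3 where split: "split_block A' 1 1 = (A1, A2, A0, A3)"
    by (cases "split_block A' 1 1") auto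
  have "dim_row A' = 1 + n1" "dim_col A' = 1 + n1" using A' n by auto
  from split_block[OF split this] have A1: "A1 \<in> carrier_mat 1 1" and A2: "A2 \<in> carrier_mat 1 n1"
    and A0: "A0 \<in> carrier_mat n1 1" and A3: "A3 \<in> carrier_mat n1 n1"
    and A'b: "A' = four_block_mat A1 A2 A0 A3" by auto
  \<comment> \<open>As \<open>v\<close> is an eigenvector for \<open>e\<close>, entry
    \<open>i\<close> is \<open>e\<close> times the inner product of columns \<open>i\<close> and 0
    of the orthogonal matrix \<open>W\<close>.\<close>
  have col0: "A' $$ (i, 0) = (if i = 0 then e else 0)" if "i < n" for i
  proof -
    have "A' $$ (i,0) = (W\<^sup>T * (A * W)) $$ (i,0)" using A W(1) by (simp add: A'_def)
    also have "\<dots> = col W i \<bullet> (A *\<^sub>v col W 0)" using A W(1) that n by (simp add: col_mult2 mult_mat_vec_def)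
    also have "\<dots> = e * (col W i \<bullet> col W 0)" using v W that n by auto
    also have "col W i \<bullet> col W 0 = (W\<^sup>T * W) $$ (i,0)" using W(1) that n by simp
    finally show ?thesis using that n by (simp add: W(2))
  qed
  have A1e: "A1 = mat 1 1 (\<lambda>_. e)"
    using split col0[of 0] A' n by (auto simp: split_block_def Let_def)
  have A00: "A0 = 0\<^sub>m n1 1"
    using split col0 A' n by (auto simp: split_block_def Let_def)
  have "similar_mat_wit A' A (W\<^sup>T) W"
    by (rule similar_mat_witI[of _ _ n]) (use W WW A A' in \<open>auto simp: A'_def\<close>)
  then have "char_poly A = char_poly A'"
    by (metis char_poly_similar similar_mat_def)
  also have "\<dots> = char_poly A1 * char_poly A3"
    unfolding A'b A00 by (rule char_poly_four_block_zeros_col[OF A1 A2 A3])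
  also have "char_poly A1 = [:- e, 1:]"
    by (simp add: A1e char_poly_defs det_def sign_def)
  finally have "char_poly A3 = (\<Prod>e\<leftarrow>es. [:- e, 1:])"
    unfolding cp by (metis mult_cancel_left pCons_eq_0_iff zero_neq_one)
  from Cons.IH[OF A3 this] obtain P where P: "P \<in> carrier_mat n1 n1" "P\<^sup>T * P = 1\<^sub>m n1"
    "diag_mat (P\<^sup>T * A3 * P) = es" by auto
  \<comment> \<open>The 1 in the corner keeps the diagonal entry \<open>e\<close> in place while
    \<open>P\<close> conjugates \<open>A3\<close>; \<open>A2\<close> only affects entries off the
    diagonal.\<close>
  define P' where "P' = four_block_mat (1\<^sub>m 1) (0\<^sub>m 1 n1) (0\<^sub>m n1 1) P"
  have P': "P' \<in> carrier_mat n n" using P(1) n by (auto simp: P'_def)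
  have P'T: "P'\<^sup>T = four_block_mat (1\<^sub>m 1) (0\<^sub>m 1 n1) (0\<^sub>m n1 1) (P\<^sup>T)"
    unfolding P'_def by (subst transpose_four_block_mat[OF _ _ _ P(1)]) auto
  have P'P': "P'\<^sup>T * P' = 1\<^sub>m n"
    unfolding P'T unfolding P'_def
    by (subst mult_four_block_mat[where ?nr1.0 = 1 and ?n1.0 = 1 and ?n2.0 = n1 and ?nr2.0 = n1 and ?nc1.0 = 1 and ?nc2.0 = n1])
       (use P n in \<open>auto\<close>)
  have "P'\<^sup>T * A' = four_block_mat A1 A2 (0\<^sub>m n1 1) (P\<^sup>T * A3)"
    unfolding P'T A'b A00
    by (subst mult_four_block_mat[where ?nr1.0 = 1 and ?n1.0 = 1 and ?n2.0 = n1 and ?nr2.0 = n1 and ?nc1.0 = 1 and ?nc2.0 = n1])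
       (use P n A1 A2 A3 in \<open>auto\<close>)
  then have "P'\<^sup>T * A' * P' = four_block_mat A1 (A2 * P) (0\<^sub>m n1 1) (P\<^sup>T * A3 * P)"
    unfolding P'_def
    by (simp, subst mult_four_block_mat[where ?nr1.0 = 1 and ?n1.0 = 1 and ?n2.0 = n1 and ?nr2.0 = n1 and ?nc1.0 = 1 and ?nc2.0 = n1])
       (use P n A1 A2 A3 in \<open>auto\<close>)
  then have "diag_mat (P'\<^sup>T * A' * P') = diag_mat A1 @ diag_mat (P\<^sup>T * A3 * P)"
    using A1 P(1) A3 by (simp add: diag_four_block_mat[where ?n1.0 = 1 and ?n2.0 = n1])
  then have diag: "diag_mat (P'\<^sup>T * A' * P') = e # es"
    by (simp only: P(3)) (simp add: A1e diag_mat_def)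
  have "(W * P')\<^sup>T * (W * P') = P'\<^sup>T * (W\<^sup>T * W) * P'"
    using W(1) P' by (simp add: transpose_mult assoc_mult_mat[of _ n n _ n _ n])
  then have 1: "(W * P')\<^sup>T * (W * P') = 1\<^sub>m n" using P' by (simp add: W(2) P'P')
  have "(W * P')\<^sup>T * A * (W * P') = P'\<^sup>T * A' * P'"
    using W(1) P' A by (simp add: A'_def transpose_mult assoc_mult_mat[of _ n n _ n _ n])
  with diag 1 W(1) P' show ?case by (intro bexI[of _ "W * P'"]) auto
qed

section \<open>Energy of orthonormal families\<close>

text \<open>Vectors are functions on the vertices, so that quadratic forms become sums over arcs
  without reference to an enumeration.\<close>

definition orthonormal_on :: "'a set \<Rightarrow> 'i set \<Rightarrow> ('i \<Rightarrow> 'a \<Rightarrow> real) \<Rightarrow> bool" where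
  "orthonormal_on V I u \<longleftrightarrow> (\<forall>i\<in>I. \<forall>j\<in>I. (\<Sum>v\<in>V. u i v * u j v) = (if i = j then 1 else 0))"

lemma orthonormal_on_norm:
  assumes "orthonormal_on V I u" "i \<in> I"
  shows "(\<Sum>v\<in>V. (u i v)\<^sup>2) = 1"
  using assms by (simp add: orthonormal_on_def power2_eq_square)

text \<open>The squared distance between \<open>x\<close> and its projection to the span of the
  \<open>u i\<close> is nonnegative; by orthonormality it is the difference of the two
  sides.\<close>

lemma bessel_inequality:
  assumes "finite I" and u: "orthonormal_on V I u"
  shows "(\<Sum>i\<in>I. (\<Sum>v\<in>V. u i v * x v)\<^sup>2) \<le> (\<Sum>v\<in>V. (x v)\<^sup>2)"
proof -
  define c where "c i = (\<Sum>v\<in>V. u i v * x v)" for i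
  have cross: "(\<Sum>v\<in>V. x v * (\<Sum>i\<in>I. c i * u i v)) = (\<Sum>i\<in>I. (c i)\<^sup>2)"
    unfolding sum_distrib_left
    by (subst sum.swap) (simp add: c_def power2_eq_square sum_distrib_left mult_ac)
  have "(\<Sum>v\<in>V. (\<Sum>i\<in>I. c i * u i v)\<^sup>2) = (\<Sum>v\<in>V. \<Sum>i\<in>I. \<Sum>j\<in>I. c i * c j * (u i v * u j v))"
    by (simp add: power2_eq_square sum_product mult_ac)
  also have "\<dots> = (\<Sum>i\<in>I. \<Sum>j\<in>I. c i * c j * (\<Sum>v\<in>V. u i v * u j v))"
    unfolding sum_distrib_left by (subst sum.swap, subst (2) sum.swap) simp
  also have "\<dots> = (\<Sum>i\<in>I. \<Sum>j\<in>I. if i = j then (c i)\<^sup>2 else 0)"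
    using u by (intro sum.cong) (auto simp: orthonormal_on_def power2_eq_square)
  also have "\<dots> = (\<Sum>i\<in>I. (c i)\<^sup>2)" using \<open>finite I\<close> by simp
  finally have square: "(\<Sum>v\<in>V. (\<Sum>i\<in>I. c i * u i v)\<^sup>2) = (\<Sum>i\<in>I. (c i)\<^sup>2)" .
  have "0 \<le> (\<Sum>v\<in>V. (x v - (\<Sum>i\<in>I. c i * u i v))\<^sup>2)" by (simp add: sum_nonneg)
  also have "\<dots> = (\<Sum>v\<in>V. (x v)\<^sup>2) - (\<Sum>i\<in>I. (c i)\<^sup>2)"
    by (simp add: power2_diff sum.distrib sum_subtractf mult.assoc cross square flip: sum_distrib_left)
  finally show ?thesis by (simp add: c_def)
qed

text \<open>Bessel's inequality for the difference of the indicators of \<open>a\<close> and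
  \<open>b\<close>, whose squared norm is 2 because the two points differ.\<close>

lemma sum_arc_energy_le:
  assumes "finite I" "finite V" "orthonormal_on V I u" "a \<in> V" "b \<in> V" "a \<noteq> b"
  shows "(\<Sum>i\<in>I. (u i a - u i b)\<^sup>2) \<le> 2"
proof -
  define x :: "_ \<Rightarrow> real" where "x v = (if v = a then 1 else 0) - (if v = b then 1 else 0)" for v
  have "(\<Sum>v\<in>V. u i v * x v) = u i a - u i b" for i
  proof -
    have "(\<Sum>v\<in>V. u i v * x v) = (\<Sum>v\<in>V. (if v = a then u i a else 0) - (if v = b then u i b else 0))"
      by (intro sum.cong) (auto simp: x_def)
    then show ?thesis using assms by (simp add: sum_subtractf)
  qed
  moreover have "(\<Sum>v\<in>V. (x v)\<^sup>2) = 2"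
  proof -
    have "(\<Sum>v\<in>V. (x v)\<^sup>2) = (\<Sum>v\<in>V. (if v = a then 1 else 0) + (if v = b then 1 else 0))"
      using assms(6) by (intro sum.cong) (auto simp: x_def)
    then show ?thesis using assms by (simp add: sum.distrib)
  qed
  ultimately show ?thesis using bessel_inequality[OF assms(1,3), of x] by simp
qed

text \<open>The sum runs over ordered pairs. For a symmetric \<open>E\<close> each edge counts
  twice, so the energy is twice the Laplacian quadratic form; all bounds for symmetric relations
  carry this factor until it is halved at the end.\<close>

definition energy :: "('a \<times> 'a) set \<Rightarrow> ('a \<Rightarrow> real) \<Rightarrow> real" where
  "energy E x = (\<Sum>(a, b)\<in>E. (x a - x b)\<^sup>2)"

lemma sum_energy_le:
  assumes "finite I" "finite V" "orthonormal_on V I u" "E \<subseteq> V \<times> V" "irrefl E"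
  shows "(\<Sum>i\<in>I. energy E (u i)) \<le> 2 * real (card E)"
proof -
  have "(\<Sum>i\<in>I. energy E (u i)) = (\<Sum>e\<in>E. \<Sum>i\<in>I. (u i (fst e) - u i (snd e))\<^sup>2)"
    unfolding energy_def by (subst sum.swap) (simp add: case_prod_beta)
  also have "\<dots> \<le> (\<Sum>e\<in>E. 2)"
    using assms by (intro sum_mono sum_arc_energy_le) (auto simp: irrefl_def)
  finally show ?thesis by simp
qed

section \<open>Energy of the complete bipartite subgraph\<close>

text \<open>\<open>w\<close> is the unit eigenvector of \<open>K\<^bsub>s1,s2\<^esub>\<close> for the eigenvalue \<open>s1 + s2\<close>.\<close>

lemma complete_bipartite_energy_le:
  fixes x :: "'a \<Rightarrow> real"
  assumes fin: "finite U" "finite W" and disj: "U \<inter> W = {}"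
    and card: "card W \<le> card U" "W \<noteq> {}"
  defines "s1 \<equiv> real (card U)" and "s2 \<equiv> real (card W)"
  defines "w \<equiv> \<lambda>v. (if v \<in> U then s2 else - s1) / sqrt (s1 * s2 * (s1 + s2))"
  shows "(\<Sum>v\<in>U \<union> W. (w v)\<^sup>2) = 1"
    and "(\<Sum>a\<in>U. \<Sum>b\<in>W. (x a - x b)\<^sup>2) \<le> s1 * (\<Sum>v\<in>U \<union> W. (x v)\<^sup>2) + s2 * (\<Sum>v\<in>U \<union> W. w v * x v)\<^sup>2"
proof -
  have "0 < card W" using fin card by (simp add: card_gt_0_iff)
  then have pos: "0 < s1" "0 < s2" "s2 \<le> s1" using card by (auto simp: s1_def s2_def)
  define r where "r = sqrt (s1 * s2 * (s1 + s2))"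
  have r2: "r\<^sup>2 = s1 * s2 * (s1 + s2)" using pos by (simp add: r_def)
  have r: "r \<noteq> 0" using pos by (simp add: r_def)
  have wW: "w v = - s1 / r" if "v \<in> W" for v using that disj by (auto simp: w_def r_def)
  have wU: "w v = s2 / r" if "v \<in> U" for v using that by (auto simp: w_def r_def)
  have "(\<Sum>v\<in>U \<union> W. (w v)\<^sup>2) = s1 * (s2 / r)\<^sup>2 + s2 * (s1 / r)\<^sup>2"
    using disj fin by (simp add: sum.union_disjoint wU wW s1_def s2_def power_divide)
  also have "\<dots> = (s1 * s2 * (s1 + s2)) / r\<^sup>2"
    using r by (simp add: power_divide field_simps power2_eq_square)
  also have "\<dots> = 1" using r by (simp add: r2[symmetric])
  finally show "(\<Sum>v\<in>U \<union> W. (w v)\<^sup>2) = 1" .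
  define SU SW QU QW where "SU = sum x U" and "SW = sum x W"
    and "QU = (\<Sum>a\<in>U. (x a)\<^sup>2)" and "QW = (\<Sum>b\<in>W. (x b)\<^sup>2)"
  have "(\<Sum>v\<in>U \<union> W. w v * x v) = (s2 * SU - s1 * SW) / r"
    using disj fin by (simp add: sum.union_disjoint wU wW SU_def SW_def diff_divide_distrib sum_distrib_left sum_negf sum_divide_distrib)
  then have "s2 * (\<Sum>v\<in>U \<union> W. w v * x v)\<^sup>2 = s2 * (s2 * SU - s1 * SW)\<^sup>2 / (s1 * s2 * (s1 + s2))"
    by (simp add: power_divide r2)
  also have "\<dots> = (s2 * SU - s1 * SW)\<^sup>2 / (s1 * (s1 + s2))" using pos by simp
  finally have 1: "s2 * (\<Sum>v\<in>U \<union> W. w v * x v)\<^sup>2 = (s2 * SU - s1 * SW)\<^sup>2 / (s1 * (s1 + s2))" .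
  have "(\<Sum>a\<in>U. \<Sum>b\<in>W. (x a - x b)\<^sup>2) = s2 * QU + s1 * QW - 2 * SU * SW"
    by (simp add: power2_diff sum.distrib sum_subtractf SU_def SW_def QU_def QW_def s1_def s2_def
        mult.assoc sum_product flip: sum_distrib_left)
  moreover have "(\<Sum>v\<in>U \<union> W. (x v)\<^sup>2) = QU + QW"
    using disj fin by (simp add: sum.union_disjoint QU_def QW_def)
  \<comment> \<open>The sum over all pairs in \<open>U\<close> is
    \<open>2 * (s1 * QU - SU\<^sup>2)\<close>, so its sign gives the Cauchy-Schwarz inequality for
    \<open>SU\<close>.\<close>
  moreover have "0 \<le> (\<Sum>a\<in>U. \<Sum>b\<in>U. (x a - x b)\<^sup>2)" by (simp add: sum_nonneg)
  then have "SU\<^sup>2 \<le> s1 * QU"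
    by (simp add: power2_diff sum.distrib sum_subtractf mult.assoc flip: sum_distrib_left sum_distrib_right)
      (simp add: SU_def QU_def s1_def power2_eq_square)
  then have "(s1 - s2) * (SU\<^sup>2 / s1) \<le> (s1 - s2) * QU"
    using pos by (intro mult_left_mono) (auto simp: field_simps)
  \<comment> \<open>Right side minus left side of the claim, with \<open>QU\<close> lowered to
    \<open>SU\<^sup>2 / s1\<close>, is a nonnegative multiple of a square. Lowering
    \<open>QU\<close> is sound because its coefficient \<open>s1 - s2\<close> is
    nonnegative.\<close>
  moreover have "(s1 - s2) * (SU\<^sup>2 / s1) + (s2 * SU - s1 * SW)\<^sup>2 / (s1 * (s1 + s2)) + 2 * SU * SW
      = s1 * (SU + SW)\<^sup>2 / (s1 + s2)"
    using pos by (simp add: divide_simps) (simp add: power2_eq_square algebra_simps)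
  moreover have "s1 * (SU + SW)\<^sup>2 / (s1 + s2) \<ge> 0" using pos by simp
  ultimately show "(\<Sum>a\<in>U. \<Sum>b\<in>W. (x a - x b)\<^sup>2) \<le> s1 * (\<Sum>v\<in>U \<union> W. (x v)\<^sup>2) + s2 * (\<Sum>v\<in>U \<union> W. w v * x v)\<^sup>2"
    unfolding 1 by (simp add: algebra_simps)
qed

text \<open>In the pointwise bound the norm terms give at most \<open>s1\<close> for each index,
  while Bessel's inequality for the unit vector \<open>w\<close> limits the other terms to
  \<open>s2\<close> in total, however many indices there are.\<close>

lemma sum_energy_complete_bipartite_le:
  fixes u :: "'i \<Rightarrow> 'a \<Rightarrow> real"
  assumes I: "finite I" and V: "finite V" and u: "orthonormal_on V I u"
    and UW: "U \<subseteq> V" "W \<subseteq> V" "U \<inter> W = {}" "card W \<le> card U" "W \<noteq> {}"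
  shows "(\<Sum>i\<in>I. energy (U \<times> W \<union> W \<times> U) (u i)) \<le> 2 * (real (card W) + real (card I) * real (card U))"
proof -
  have fin: "finite U" "finite W" using UW V by (auto intro: finite_subset)
  define s1 s2 where "s1 = real (card U)" and "s2 = real (card W)"
  define w where "w v = (if v \<in> U then s2 else - s1) / sqrt (s1 * s2 * (s1 + s2))" for v
  have K: "(\<Sum>v\<in>U \<union> W. (w v)\<^sup>2) = 1"
    "(\<Sum>a\<in>U. \<Sum>b\<in>W. (x a - x b)\<^sup>2) \<le> s1 * (\<Sum>v\<in>U \<union> W. (x v)\<^sup>2) + s2 * (\<Sum>v\<in>U \<union> W. w v * x v)\<^sup>2" for x
    using complete_bipartite_energy_le[OF fin UW(3-5)] unfolding s1_def s2_def w_def by auto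
  have "energy (U \<times> W \<union> W \<times> U) x = 2 * (\<Sum>a\<in>U. \<Sum>b\<in>W. (x a - x b)\<^sup>2)" for x :: "'a \<Rightarrow> real"
  proof -
    have "energy (U \<times> W \<union> W \<times> U) x = energy (U \<times> W) x + energy (W \<times> U) x"
      unfolding energy_def using fin UW(3) by (intro sum.union_disjoint) auto
    moreover have "energy (W \<times> U) x = energy (U \<times> W) x"
      unfolding energy_def by (rule sum.reindex_bij_witness[of _ prod.swap prod.swap])
        (auto simp: power2_commute)
    ultimately show ?thesis by (simp add: energy_def sum.cartesian_product)
  qed
  then have "(\<Sum>i\<in>I. energy (U \<times> W \<union> W \<times> U) (u i))
      = 2 * (\<Sum>i\<in>I. \<Sum>a\<in>U. \<Sum>b\<in>W. (u i a - u i b)\<^sup>2)" by (simp add: sum_distrib_left)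
  also have "(\<Sum>i\<in>I. \<Sum>a\<in>U. \<Sum>b\<in>W. (u i a - u i b)\<^sup>2)
      \<le> (\<Sum>i\<in>I. s1 * (\<Sum>v\<in>U \<union> W. (u i v)\<^sup>2) + s2 * (\<Sum>v\<in>U \<union> W. w v * u i v)\<^sup>2)"
    by (intro sum_mono K(2))
  also have "\<dots> \<le> (\<Sum>i\<in>I. s1 * 1 + s2 * (\<Sum>v\<in>U \<union> W. w v * u i v)\<^sup>2)"
  proof (intro sum_mono add_mono order_refl mult_left_mono)
    fix i assume "i \<in> I"
    have "(\<Sum>v\<in>U \<union> W. (u i v)\<^sup>2) \<le> (\<Sum>v\<in>V. (u i v)\<^sup>2)" using UW V by (intro sum_mono2) auto
    then show "(\<Sum>v\<in>U \<union> W. (u i v)\<^sup>2) \<le> 1" using orthonormal_on_norm[OF u \<open>i \<in> I\<close>] by simp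
  qed (simp add: s1_def)
  also have "\<dots> = s1 * card I + s2 * (\<Sum>i\<in>I. (\<Sum>v\<in>U \<union> W. w v * u i v)\<^sup>2)"
    by (simp add: sum.distrib sum_distrib_left)
  also have "\<dots> \<le> s1 * card I + s2 * 1"
  proof (intro add_mono order_refl mult_left_mono)
    \<comment> \<open>The family is orthonormal on \<open>V\<close> only, so \<open>w\<close> is
      extended by zero before Bessel's inequality is applied.\<close>
    define x where "x v = (if v \<in> U \<union> W then w v else 0)" for v
    have "(\<Sum>v\<in>V. u i v * x v) = (\<Sum>v\<in>U \<union> W. w v * u i v)" for i
      using UW V by (intro sum.mono_neutral_cong_right) (auto simp: x_def)
    moreover have "(\<Sum>v\<in>V. (x v)\<^sup>2) = (\<Sum>v\<in>U \<union> W. (w v)\<^sup>2)"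
      using UW V by (intro sum.mono_neutral_cong_right) (auto simp: x_def)
    ultimately show "(\<Sum>i\<in>I. (\<Sum>v\<in>U \<union> W. w v * u i v)\<^sup>2) \<le> 1"
      using bessel_inequality[OF I u, of x] K(1) by simp
  qed (simp add: s2_def)
  finally show ?thesis by (simp add: s1_def s2_def mult.commute)
qed

section \<open>Stars and star forests\<close>

text \<open>It vanishes off the star, so the vectors of disjoint stars are orthogonal.\<close>

definition star_vector :: "'a \<Rightarrow> 'a set \<Rightarrow> 'a \<Rightarrow> real" where
  "star_vector c L v = (if v = c then real (card L) else if v \<in> L then - 1 else 0)
     / sqrt (real (card L) * (real (card L) + 1))"

lemma star_vector_norm:
  assumes "finite L" "L \<noteq> {}" "c \<notin> L"
  shows "(\<Sum>v\<in>insert c L. (star_vector c L v)\<^sup>2) = 1"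
proof -
  define e where "e = real (card L)"
  have e: "0 < e" using assms by (simp add: e_def card_gt_0_iff)
  have "(\<Sum>v\<in>L. (star_vector c L v)\<^sup>2) = (\<Sum>v\<in>L. 1 / (e * (e + 1)))"
    using e assms(3) by (intro sum.cong) (auto simp: star_vector_def e_def[symmetric] power_divide)
  then have "(\<Sum>v\<in>insert c L. (star_vector c L v)\<^sup>2) = e\<^sup>2 / (e * (e + 1)) + e / (e * (e + 1))"
    using assms e by (simp add: star_vector_def e_def[symmetric] power_divide)
  also have "\<dots> = e * (e + 1) / (e * (e + 1))"
    by (simp only: power2_eq_square distrib_left mult_1_right flip: add_divide_distrib)
  also have "\<dots> = 1" using e by simp
  finally show ?thesis .
qed

text \<open>The largest Laplacian eigenvalue of a star with \<open>e\<close> leaves is \<open>e + 1\<close>, with eigenvector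
  \<^const>\<open>star_vector\<close>, and all others are at most 1.\<close>

lemma star_energy_le:
  fixes x :: "'a \<Rightarrow> real"
  assumes "finite L" "L \<noteq> {}" "c \<notin> L"
  shows "(\<Sum>l\<in>L. (x l - x c)\<^sup>2) \<le> (\<Sum>v\<in>insert c L. (x v)\<^sup>2)
    + real (card L) * (\<Sum>v\<in>insert c L. star_vector c L v * x v)\<^sup>2"
proof -
  define e S Q where "e = real (card L)" and "S = sum x L" and "Q = (\<Sum>v\<in>L. (x v)\<^sup>2)"
  have e: "0 < e" using assms by (simp add: e_def card_gt_0_iff)
  define r where "r = sqrt (e * (e + 1))"
  have r2: "r\<^sup>2 = e * (e + 1)" using e by (simp add: r_def)
  have "(\<Sum>v\<in>L. star_vector c L v * x v) = (\<Sum>v\<in>L. - x v / r)"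
    using e assms(3) by (intro sum.cong) (auto simp: star_vector_def e_def[symmetric] r_def)
  then have "(\<Sum>v\<in>insert c L. star_vector c L v * x v) = (e * x c - S) / r"
    using assms e by (simp add: diff_divide_distrib sum_divide_distrib[symmetric] sum_negf S_def)
       (simp add: star_vector_def e_def[symmetric] r_def[symmetric])
  then have "e * (\<Sum>v\<in>insert c L. star_vector c L v * x v)\<^sup>2 = (e * x c - S)\<^sup>2 / (e + 1)"
    using e by (simp add: power_divide r2)
  moreover have "(\<Sum>l\<in>L. (x l - x c)\<^sup>2) = Q + e * (x c)\<^sup>2 - 2 * S * x c"
    by (simp add: power2_diff sum.distrib sum_subtractf Q_def S_def e_def flip: sum_distrib_left sum_distrib_right)
  moreover have "(\<Sum>v\<in>insert c L. (x v)\<^sup>2) = (x c)\<^sup>2 + Q" using assms by (simp add: Q_def)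
  \<comment> \<open>The left side is the right side minus the left side of the claim, after
    \<open>Q\<close> cancels.\<close>
  moreover have "(x c)\<^sup>2 + (e * x c - S)\<^sup>2 / (e + 1) - (e * (x c)\<^sup>2 - 2 * S * x c) = (x c + S)\<^sup>2 / (e + 1)"
    using e by (simp add: divide_simps) (simp add: power2_eq_square algebra_simps)
  moreover have "(x c + S)\<^sup>2 / (e + 1) \<ge> 0" using e by simp
  ultimately show ?thesis by (simp add: e_def[symmetric])
qed

text \<open>\<open>\<phi>\<close> sends each vertex to the centre of its star; every star has at least one leaf.\<close>

definition star_forest :: "('a \<times> 'a) set \<Rightarrow> 'a set \<Rightarrow> ('a \<Rightarrow> 'a) \<Rightarrow> bool" where
  "star_forest E N \<phi> \<longleftrightarrow> (\<forall>v\<in>N. \<phi> v \<in> N \<and> \<phi> (\<phi> v) = \<phi> v \<and> (\<phi> v \<noteq> v \<longrightarrow> (v, \<phi> v) \<in> E) \<and>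
     (\<exists>l\<in>N. l \<noteq> \<phi> v \<and> \<phi> l = \<phi> v))"

text \<open>With \<open>e\<close> leaves at a centre, the weight \<open>e\<close> of its star vector
  is split as \<open>(e - 1) + 1\<close>. Bessel's inequality for the family \<open>u\<close> bounds
  the parts \<open>e - 1\<close>, which add up to \<open>card N - 2 t\<close>; Bessel's inequality
  for the star vectors bounds the parts 1 by one for each index. The norm terms add one more for
  each index.\<close>

lemma sum_star_forest_energy_le:
  assumes I: "finite I" and V: "finite V" and u: "orthonormal_on V I u"
    and N: "N \<subseteq> V" and \<phi>: "star_forest E N \<phi>"
  defines "t \<equiv> card {c \<in> N. \<phi> c = c}"
  shows "(\<Sum>i\<in>I. \<Sum>v\<in>N. (u i v - u i (\<phi> v))\<^sup>2) \<le> real (card N) - 2 * real t + 2 * real (card I)"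
proof -
  have finN: "finite N" using N V by (rule finite_subset)
  define C where "C = {c \<in> N. \<phi> c = c}"
  define L where "L c = {v \<in> N. \<phi> v = c \<and> v \<noteq> c}" for c
  define w where "w c v = star_vector c (L c) v" for c v
  define \<alpha> where "\<alpha> c i = (\<Sum>v\<in>V. w c v * u i v)" for c i
  have finC: "finite C" using finN by (simp add: C_def)
  have finL: "finite (L c)" for c using finN by (simp add: L_def)
  have Lne: "L c \<noteq> {}" if "c \<in> C" for c
  proof -
    have c: "c \<in> N" "\<phi> c = c" using that by (simp_all add: C_def)
    then obtain l where "l \<in> N" "l \<noteq> c" "\<phi> l = c" using \<phi> unfolding star_forest_def by metis
    then show ?thesis by (auto simp: L_def)
  qed
  have cL: "c \<notin> L c" for c by (simp add: L_def)
  have star: "insert c (L c) = {v \<in> N. \<phi> v = c}" if "c \<in> C" for c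
    using that by (auto simp: C_def L_def)
  have sub: "insert c (L c) \<subseteq> V" if "c \<in> C" for c using star[OF that] N by auto
  have N_eq: "sum f N = (\<Sum>c\<in>C. sum f (insert c (L c)))" for f :: "_ \<Rightarrow> real"
  proof -
    have "\<phi> ` N \<subseteq> C" using \<phi> by (auto simp: star_forest_def C_def)
    then have "(\<Sum>c\<in>C. sum f {v \<in> N. \<phi> v = c}) = sum f N" by (intro sum.group finN finC)
    then show ?thesis by (simp add: star)
  qed
  have w0: "w c v = 0" if "v \<notin> insert c (L c)" for c v using that by (simp add: w_def star_vector_def)
  have restr: "(\<Sum>v\<in>V. w c v * f v) = (\<Sum>v\<in>insert c (L c). w c v * f v)" if "c \<in> C" for c f
    using V sub[OF that] w0 by (intro sum.mono_neutral_right) auto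
  have w_orth: "orthonormal_on V C w"
    unfolding orthonormal_on_def
  proof (intro ballI)
    fix c d assume cd: "c \<in> C" "d \<in> C"
    show "(\<Sum>v\<in>V. w c v * w d v) = (if c = d then 1 else 0)"
    proof (cases "c = d")
      case True
      then show ?thesis using star_vector_norm[OF finL Lne[OF cd(1)] cL] restr[OF cd(1)]
        by (simp add: w_def[symmetric] power2_eq_square)
    next
      case False
      then have "w c v * w d v = 0" for v using star[OF cd(1)] star[OF cd(2)] w0[of v c] w0[of v d]
        by (cases "v \<in> insert c (L c)") auto
      then have "(\<Sum>v\<in>V. w c v * w d v) = 0" by (intro sum.neutral) auto
      then show ?thesis using False by simp
    qed
  qed
  \<comment> \<open>Bessel's inequality in both directions: star vectors are projected on the family
    \<open>u\<close>, and in \<open>a2\<close> each \<open>u i\<close> on the star vectors.\<close>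
  have a1: "(\<Sum>i\<in>I. (\<alpha> c i)\<^sup>2) \<le> 1" if "c \<in> C" for c
    using bessel_inequality[OF I u, of "w c"] orthonormal_on_norm[OF w_orth that]
    by (simp add: \<alpha>_def mult.commute)
  have a2: "(\<Sum>c\<in>C. (\<alpha> c i)\<^sup>2) \<le> 1" if "i \<in> I" for i
    using bessel_inequality[OF finC w_orth, of "u i"] orthonormal_on_norm[OF u that]
    by (simp add: \<alpha>_def)
  have cardN: "real (card N) = (\<Sum>c\<in>C. real (card (L c))) + real (card C)"
    using N_eq[of "\<lambda>_. 1"] finL cL by (simp add: sum.distrib)
  have "(\<Sum>v\<in>N. (u i v - u i (\<phi> v))\<^sup>2) \<le> 1 + (\<Sum>c\<in>C. real (card (L c)) * (\<alpha> c i)\<^sup>2)" if i: "i \<in> I" for i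
  proof -
    have "(\<Sum>v\<in>N. (u i v - u i (\<phi> v))\<^sup>2) = (\<Sum>c\<in>C. \<Sum>v\<in>L c. (u i v - u i c)\<^sup>2)"
      unfolding N_eq
    proof (rule sum.cong[OF refl])
      fix c assume c: "c \<in> C"
      have "(\<Sum>v\<in>insert c (L c). (u i v - u i (\<phi> v))\<^sup>2) = (\<Sum>v\<in>insert c (L c). (u i v - u i c)\<^sup>2)"
        using star[OF c] by (intro sum.cong) auto
      then show "(\<Sum>v\<in>insert c (L c). (u i v - u i (\<phi> v))\<^sup>2) = (\<Sum>v\<in>L c. (u i v - u i c)\<^sup>2)"
        using finL cL by simp
    qed
    also have "\<dots> \<le> (\<Sum>c\<in>C. (\<Sum>v\<in>insert c (L c). (u i v)\<^sup>2) + real (card (L c)) * (\<alpha> c i)\<^sup>2)"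
      using star_energy_le[OF finL Lne cL, of _ "u i"] by (intro sum_mono) (simp add: \<alpha>_def restr w_def[symmetric])
    also have "\<dots> = (\<Sum>v\<in>N. (u i v)\<^sup>2) + (\<Sum>c\<in>C. real (card (L c)) * (\<alpha> c i)\<^sup>2)"
      by (simp add: sum.distrib N_eq)
    also have "(\<Sum>v\<in>N. (u i v)\<^sup>2) \<le> 1"
      using orthonormal_on_norm[OF u i] sum_mono2[OF V N, of "\<lambda>v. (u i v)\<^sup>2"] by simp
    finally show ?thesis by simp
  qed
  then have "(\<Sum>i\<in>I. \<Sum>v\<in>N. (u i v - u i (\<phi> v))\<^sup>2)
      \<le> (\<Sum>i\<in>I. 1 + (\<Sum>c\<in>C. real (card (L c)) * (\<alpha> c i)\<^sup>2))" by (rule sum_mono)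
  also have "\<dots> = real (card I) + (\<Sum>c\<in>C. real (card (L c)) * (\<Sum>i\<in>I. (\<alpha> c i)\<^sup>2))"
    unfolding sum_distrib_left sum.distrib by (subst sum.swap) simp
  also have "\<dots> \<le> real (card I) + (\<Sum>c\<in>C. real (card (L c)) - 1 + (\<Sum>i\<in>I. (\<alpha> c i)\<^sup>2))"
  proof (intro add_mono order_refl sum_mono)
    fix c assume c: "c \<in> C"
    have "1 \<le> real (card (L c))" using Lne[OF c] finL by (simp add: Suc_le_eq card_gt_0_iff)
    \<comment> \<open>The factor is nonnegative because every star has a leaf.\<close>
    then have "(real (card (L c)) - 1) * (\<Sum>i\<in>I. (\<alpha> c i)\<^sup>2) \<le> (real (card (L c)) - 1) * 1"
      by (intro mult_left_mono a1 c) auto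
    then show "real (card (L c)) * (\<Sum>i\<in>I. (\<alpha> c i)\<^sup>2) \<le> real (card (L c)) - 1 + (\<Sum>i\<in>I. (\<alpha> c i)\<^sup>2)"
      by (simp add: algebra_simps)
  qed
  also have "\<dots> = real (card I) + (real (card N) - 2 * real t) + (\<Sum>i\<in>I. \<Sum>c\<in>C. (\<alpha> c i)\<^sup>2)"
    by (subst sum.swap) (simp add: sum.distrib sum_subtractf cardN t_def C_def)
  also have "\<dots> \<le> real (card I) + (real (card N) - 2 * real t) + (\<Sum>i\<in>I. 1)"
    by (intro add_mono order_refl sum_mono a2)
  finally show ?thesis by simp
qed

text \<open>A new vertex \<open>v\<close> is attached to a neighbour \<open>w\<close>. If \<open>w\<close> is a leaf, it leaves its star and becomes the
  centre of a new one, except when it is the only leaf there: then that star is re-rooted at \<open>w\<close>.\<close>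

lemma ex_star_forest:
  assumes "finite N" "sym E" "irrefl E" and nbr: "\<And>v. v \<in> N \<Longrightarrow> \<exists>w\<in>N. (v, w) \<in> E"
  shows "\<exists>\<phi>. star_forest E N \<phi>"
proof -
  \<comment> \<open>The covered set \<open>T\<close> may exceed \<open>S\<close>, since covering a
    vertex can force its neighbour to be covered too. For \<open>S = N\<close> both
    coincide.\<close>
  have "\<exists>T \<phi>. S \<subseteq> T \<and> T \<subseteq> N \<and> star_forest E T \<phi>" if "finite S" "S \<subseteq> N" for S
    using that
  proof induction
    case empty
    show ?case by (intro exI[of _ "{}"]) (auto simp: star_forest_def)
  next
    case (insert v S)
    then obtain T \<phi> where T: "S \<subseteq> T" "T \<subseteq> N" "star_forest E T \<phi>" by auto
    show ?case
    proof (cases "v \<in> T")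
      case True
      then show ?thesis using T by auto
    next
      case False
      obtain w where w: "w \<in> N" "(v, w) \<in> E" using nbr insert.prems by auto
      have wv: "(w, v) \<in> E" "v \<noteq> w" using w assms(2,3) by (auto dest: symD simp: irrefl_def)
      have I: "insert v S \<subseteq> insert v (insert w T)" "insert v (insert w T) \<subseteq> N" using T w insert.prems by auto
      have \<phi>: "\<phi> x \<in> T" "\<phi> (\<phi> x) = \<phi> x" "\<phi> x \<noteq> x \<Longrightarrow> (x, \<phi> x) \<in> E"
          "\<exists>l\<in>T. l \<noteq> \<phi> x \<and> \<phi> l = \<phi> x" if "x \<in> T" for x
        using T(3) that by (auto simp: star_forest_def)
      \<comment> \<open>In order: \<open>w\<close> is uncovered, a centre, a leaf beside other
        leaves, or the only leaf of its star.\<close>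
      consider "w \<notin> T" | "w \<in> T" "\<phi> w = w"
        | "w \<in> T" "\<phi> w \<noteq> w" "\<exists>l\<in>T. l \<noteq> \<phi> w \<and> l \<noteq> w \<and> \<phi> l = \<phi> w"
        | "w \<in> T" "\<phi> w \<noteq> w" "\<And>l. l \<in> T \<Longrightarrow> \<phi> l = \<phi> w \<Longrightarrow> l = \<phi> w \<or> l = w" by blast
      then have "\<exists>\<phi>. star_forest E (insert v (insert w T)) \<phi>"
      proof cases
        case 1
        define \<psi> where "\<psi> = \<phi>(v := w, w := w)"
        have "star_forest E (insert v (insert w T)) \<psi>"
          unfolding star_forest_def
        proof (rule ballI)
          fix x assume "x \<in> insert v (insert w T)"
          then consider "x \<in> {v, w}" | "x \<in> T" "x \<noteq> v" "x \<noteq> w" by blast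
          then show "\<psi> x \<in> insert v (insert w T) \<and> \<psi> (\<psi> x) = \<psi> x \<and> (\<psi> x \<noteq> x \<longrightarrow> (x, \<psi> x) \<in> E) \<and>
            (\<exists>l\<in>insert v (insert w T). l \<noteq> \<psi> x \<and> \<psi> l = \<psi> x)"
          proof cases
            case 2
            then have "\<phi> x \<noteq> v" "\<phi> x \<noteq> w" using \<phi>(1)[of x] False \<open>w \<notin> T\<close> by auto
            moreover obtain l where "l \<in> T" "l \<noteq> \<phi> x" "\<phi> l = \<phi> x" using \<phi>(4) 2 by blast
            ultimately show ?thesis using 2 \<phi>(1-3)[of x] False \<open>w \<notin> T\<close>
              by (auto simp: \<psi>_def intro!: bexI[of _ l])
          qed (use w wv in \<open>auto simp: \<psi>_def\<close>)
        qed
        then show ?thesis by blast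
      next
        case 2
        define \<psi> where "\<psi> = \<phi>(v := w)"
        have "star_forest E (insert v (insert w T)) \<psi>"
          unfolding star_forest_def
        proof (rule ballI)
          fix x assume "x \<in> insert v (insert w T)"
          then consider "x = v" | "x \<in> T" "x \<noteq> v" using \<open>w \<in> T\<close> by blast
          then show "\<psi> x \<in> insert v (insert w T) \<and> \<psi> (\<psi> x) = \<psi> x \<and> (\<psi> x \<noteq> x \<longrightarrow> (x, \<psi> x) \<in> E) \<and>
            (\<exists>l\<in>insert v (insert w T). l \<noteq> \<psi> x \<and> \<psi> l = \<psi> x)"
          proof cases
            case 2
            then have "\<phi> x \<noteq> v" using \<phi>(1)[of x] False by auto
            moreover obtain l where "l \<in> T" "l \<noteq> \<phi> x" "\<phi> l = \<phi> x" using \<phi>(4) 2 by blast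
            ultimately show ?thesis using 2 \<phi>(1-3)[of x] False by (auto simp: \<psi>_def intro!: bexI[of _ l])
          qed (use 2 w wv in \<open>auto simp: \<psi>_def\<close>)
        qed
        then show ?thesis by blast
      next
        case 3
        then obtain k where k: "k \<in> T" "k \<noteq> \<phi> w" "k \<noteq> w" "\<phi> k = \<phi> w" by blast
        define \<psi> where "\<psi> = \<phi>(v := w, w := w)"
        have "star_forest E (insert v (insert w T)) \<psi>"
          unfolding star_forest_def
        proof (rule ballI)
          fix x assume "x \<in> insert v (insert w T)"
          then consider "x \<in> {v, w}" | "x \<in> T" "x \<noteq> v" "x \<noteq> w" by blast
          then show "\<psi> x \<in> insert v (insert w T) \<and> \<psi> (\<psi> x) = \<psi> x \<and> (\<psi> x \<noteq> x \<longrightarrow> (x, \<psi> x) \<in> E) \<and>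
            (\<exists>l\<in>insert v (insert w T). l \<noteq> \<psi> x \<and> \<psi> l = \<psi> x)"
          proof cases
            case x: 2
            have "\<phi> x \<noteq> v" using x \<phi>(1)[of x] False by auto
            moreover have "\<phi> x \<noteq> w" using \<phi>(2)[OF x(1)] 3(2) by metis
            moreover obtain l where "l \<in> T" "l \<noteq> \<phi> x" "\<phi> l = \<phi> x" "l \<noteq> w"
              using \<phi>(4)[OF x(1)] k by metis
            moreover from this have "l \<noteq> v" using False by auto
            ultimately show ?thesis using x \<phi>(1-3)[of x] by (auto simp: \<psi>_def intro!: bexI[of _ l])
          qed (use w wv in \<open>auto simp: \<psi>_def\<close>)
        qed
        then show ?thesis by blast
      next
        case 4
        have cw: "(\<phi> w, w) \<in> E" using 4(1,2) \<phi>(3)[of w] assms(2) by (auto dest: symD)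
        have cT: "\<phi> w \<in> T" "\<phi> (\<phi> w) = \<phi> w" using 4 \<phi> by auto
        \<comment> \<open>The old star is the single edge between \<open>w\<close> and
          \<open>\<phi> w\<close>. Both \<open>v\<close> and the old centre become leaves of
          \<open>w\<close>; symmetry of \<open>E\<close> supplies the reversed arc.\<close>
        define \<psi> where "\<psi> = \<phi>(v := w, w := w, \<phi> w := w)"
        have "star_forest E (insert v (insert w T)) \<psi>"
          unfolding star_forest_def
        proof (rule ballI)
          fix x assume "x \<in> insert v (insert w T)"
          then consider "x \<in> {v, w}" | "x = \<phi> w" | "x \<in> T" "x \<noteq> v" "x \<noteq> w" "x \<noteq> \<phi> w" by blast
          then show "\<psi> x \<in> insert v (insert w T) \<and> \<psi> (\<psi> x) = \<psi> x \<and> (\<psi> x \<noteq> x \<longrightarrow> (x, \<psi> x) \<in> E) \<and>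
            (\<exists>l\<in>insert v (insert w T). l \<noteq> \<psi> x \<and> \<psi> l = \<psi> x)"
          proof cases
            case x: 3
            \<comment> \<open>The re-rooted star had no further vertices, so the star of
              \<open>x\<close> is a different one and stays intact.\<close>
            have c: "\<phi> x \<noteq> \<phi> w" using 4(3) x by metis
            have "\<phi> x \<noteq> v" using x \<phi>(1)[of x] False by auto
            moreover have "\<phi> x \<noteq> w" using \<phi>(2)[OF x(1)] 4(2) by metis
            moreover obtain l where "l \<in> T" "l \<noteq> \<phi> x" "\<phi> l = \<phi> x" "l \<noteq> w" "l \<noteq> \<phi> w"
              using \<phi>(4)[OF x(1)] c cT by metis
            moreover from this have "l \<noteq> v" using False by auto
            ultimately show ?thesis using x c \<phi>(1-3)[of x] by (auto simp: \<psi>_def intro!: bexI[of _ l])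
          qed (use w wv cw 4 False in \<open>auto simp: \<psi>_def\<close>)
        qed
        then show ?thesis by blast
      qed
      then show ?thesis using I by blast
    qed
  qed
  from this[OF assms(1) order_refl] show ?thesis by (metis subset_antisym)
qed

text \<open>The forest arcs in both directions, \<open>F\<close> and \<open>F'\<close>, receive the
  star bound and every other arc at most 2. With \<open>t\<close> centres and \<open>k\<close>
  indices the total is \<open>2 (card N - 2 t + 2 k) + 2 (card E - 2 (card N - t))\<close>, where
  \<open>t\<close> cancels.\<close>

lemma sum_energy_le_card_Domain:
  fixes u :: "'i \<Rightarrow> 'a \<Rightarrow> real"
  assumes I: "finite I" and V: "finite V" and u: "orthonormal_on V I u"
    and E: "E \<subseteq> V \<times> V" "sym E" "irrefl E"
  shows "(\<Sum>i\<in>I. energy E (u i)) \<le> 2 * (real (card E) - real (card (Domain E)) + 2 * real (card I))"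
proof -
  define N where "N = Domain E"
  have N: "N \<subseteq> V" using E by (auto simp: N_def)
  have finN: "finite N" using N V by (rule finite_subset)
  have finE: "finite E" using E V by (auto intro: finite_subset)
  obtain \<phi> where \<phi>: "star_forest E N \<phi>"
    using ex_star_forest[OF finN E(2,3)] E(2) by (auto simp: N_def dest: symD)
  define C where "C = {c \<in> N. \<phi> c = c}"
  define F where "F = (\<lambda>v. (v, \<phi> v)) ` (N - C)"
  define F' where "F' = (\<lambda>v. (\<phi> v, v)) ` (N - C)"
  have "inj_on (\<lambda>v. (v, \<phi> v)) (N - C)" "inj_on (\<lambda>v. (\<phi> v, v)) (N - C)" by (auto simp: inj_on_def)
  note inj = this
  have FE: "F \<subseteq> E" "F' \<subseteq> E" using \<phi> E(2) by (auto simp: F_def F'_def C_def star_forest_def dest: symD)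
  \<comment> \<open>Arcs of \<open>F\<close> start at leaves and arcs of \<open>F'\<close> at
    centres.\<close>
  have disj: "F \<inter> F' = {}" using \<phi> by (auto simp: F_def F'_def C_def star_forest_def)
  have fin: "finite F" "finite F'" using finN by (auto simp: F_def F'_def)
  have CN: "C \<subseteq> N" by (auto simp: C_def)
  then have "card (N - C) = card N - card C" "card C \<le> card N"
    using finN by (auto intro: card_Diff_subset card_mono finite_subset)
  then have cardNC: "real (card (N - C)) = real (card N) - real (card C)" by simp
  have "card (F \<union> F') = 2 * card (N - C)"
    using card_Un_disjoint[OF fin disj] inj by (simp add: F_def F'_def card_image)
  moreover have "card (E - (F \<union> F')) = card E - card (F \<union> F')" "card (F \<union> F') \<le> card E"
    using FE finE fin by (auto intro!: card_Diff_subset card_mono)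
  ultimately have card_rest: "real (card (E - (F \<union> F'))) = real (card E) - 2 * (real (card N) - real (card C))"
    using cardNC by simp
  have split: "energy E x = 2 * (\<Sum>v\<in>N. (x v - x (\<phi> v))\<^sup>2) + energy (E - (F \<union> F')) x" for x :: "'a \<Rightarrow> real"
  proof -
    have "energy E x = energy (F \<union> F') x + energy (E - (F \<union> F')) x"
      unfolding energy_def using finE FE sum.subset_diff[of "F \<union> F'" E] by (simp add: add.commute)
    moreover have "energy (F \<union> F') x = energy F x + energy F' x"
      unfolding energy_def using fin disj by (rule sum.union_disjoint)
    moreover have "energy F x = (\<Sum>v\<in>N - C. (x v - x (\<phi> v))\<^sup>2)"
      unfolding energy_def F_def by (simp add: sum.reindex inj)
    moreover have "energy F' x = (\<Sum>v\<in>N - C. (x v - x (\<phi> v))\<^sup>2)"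
      unfolding energy_def F'_def by (simp add: sum.reindex inj power2_commute)
    moreover have "(\<Sum>v\<in>N - C. (x v - x (\<phi> v))\<^sup>2) = (\<Sum>v\<in>N. (x v - x (\<phi> v))\<^sup>2)"
      using finN by (intro sum.mono_neutral_left) (auto simp: C_def)
    ultimately show ?thesis by simp
  qed
  have "(\<Sum>i\<in>I. energy E (u i)) = 2 * (\<Sum>i\<in>I. \<Sum>v\<in>N. (u i v - u i (\<phi> v))\<^sup>2)
      + (\<Sum>i\<in>I. energy (E - (F \<union> F')) (u i))"
    by (simp add: split sum.distrib sum_distrib_left)
  also have "\<dots> \<le> 2 * (real (card N) - 2 * real (card C) + 2 * real (card I))
      + 2 * real (card (E - (F \<union> F')))"
    using E unfolding C_def
    by (intro add_mono mult_left_mono sum_star_forest_energy_le[OF I V u N \<phi>] sum_energy_le[OF I V u])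
       (auto simp: irrefl_def)
  finally show ?thesis unfolding card_rest by (simp add: N_def algebra_simps)
qed

section \<open>Laplacian eigenvalues and energy\<close>

text \<open>For an eigenvector \<open>v\<close> the Hermitian form \<open>s\<close> equals its own
  conjugate by symmetry of \<open>A\<close>, and it is also \<open>z\<close> times the nonzero real
  number \<open>N\<close>.\<close>

lemma symmetric_mat_eigenvalue_real:
  fixes A :: "real mat"
  assumes A: "A \<in> carrier_mat n n" and sym: "A\<^sup>T = A"
    and ev: "eigenvalue (map_mat complex_of_real A) z"
  shows "z \<in> \<real>"
proof -
  define C where "C = map_mat complex_of_real A"
  have C: "C \<in> carrier_mat n n" using A by (simp add: C_def)
  obtain v where v: "v \<in> carrier_vec n" "v \<noteq> 0\<^sub>v n" "C *\<^sub>v v = z \<cdot>\<^sub>v v"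
    using ev C unfolding C_def[symmetric] by (auto simp: eigenvalue_def eigenvector_def)
  have Cij: "C $$ (i, j) = complex_of_real (A $$ (j, i))" if "i < n" "j < n" for i j
  proof -
    have "A $$ (i, j) = A\<^sup>T $$ (i, j)" by (simp add: sym)
    then show ?thesis using that A by (simp add: C_def)
  qed
  have eq: "(\<Sum>j<n. complex_of_real (A $$ (i, j)) * v $ j) = z * v $ i" if "i < n" for i
  proof -
    have "(C *\<^sub>v v) $ i = z * v $ i" using v that by simp
    then show ?thesis using that A v(1) by (simp add: C_def mult_mat_vec_def scalar_prod_def atLeast0LessThan)
  qed
  define s where "s = (\<Sum>i<n. \<Sum>j<n. complex_of_real (A $$ (i, j)) * v $ j * cnj (v $ i))"
  have Asym: "A $$ (i, j) = A $$ (j, i)" if "i < n" "j < n" for i j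
    using that A arg_cong[OF sym, of "\<lambda>B. B $$ (j, i)"] by simp
  have "cnj s = s"
    unfolding s_def cnj_sum by (subst sum.swap) (intro sum.cong refl, auto simp: Asym mult_ac)
  define N where "N = (\<Sum>i<n. (cmod (v $ i))\<^sup>2)"
  have "s = z * complex_of_real N"
    unfolding s_def N_def of_real_sum sum_distrib_left
  proof (rule sum.cong[OF refl])
    fix i assume "i \<in> {..<n}"
    then have "i < n" by simp
    then show "(\<Sum>j<n. complex_of_real (A $$ (i, j)) * v $ j * cnj (v $ i)) = z * complex_of_real ((cmod (v $ i))\<^sup>2)"
      by (simp only: complex_norm_square eq flip: mult.assoc sum_distrib_right)
  qed
  moreover have "N \<noteq> 0"
  proof
    assume "N = 0"
    then have "v $ i = 0" if "i < n" for i using that by (simp add: N_def sum_nonneg_eq_0_iff)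
    then show False using v by (auto simp: vec_eq_iff)
  qed
  ultimately have "cnj z = z" using \<open>cnj s = s\<close> by simp
  then show ?thesis by (simp add: Reals_cnj_iff)
qed

text \<open>The polynomial is factored over the complex numbers; all its roots are real, and
  injectivity of the embedding brings the factorization back.\<close>

lemma char_poly_symmetric_splits:
  fixes A :: "real mat"
  assumes A: "A \<in> carrier_mat n n" and sym: "A\<^sup>T = A"
  shows "\<exists>es. char_poly A = (\<Prod>e\<leftarrow>es. [:- e, 1:])"
proof -
  have C: "map_mat complex_of_real A \<in> carrier_mat n n" using A by simp
  interpret of_real: map_poly_inj_comm_ring_hom complex_of_real ..
  obtain as where as: "char_poly (map_mat complex_of_real A) = (\<Prod>a\<leftarrow>as. [:- a, 1:])"
    using char_poly_factorized[OF C] by blast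
  have "a \<in> \<real>" if "a \<in> set as" for a
  proof -
    have "poly (char_poly (map_mat complex_of_real A)) a = 0"
      using linear_poly_root[OF that] by (simp add: as)
    then show ?thesis using symmetric_mat_eigenvalue_real[OF A sym] eigenvalue_root_char_poly[OF C] by blast
  qed
  then have Re: "map (\<lambda>a. [:- a, 1:]) as = map (\<lambda>a. map_poly complex_of_real [:- Re a, 1:]) as"
    by (intro map_cong refl) (simp add: map_poly_pCons)
  have "map_poly complex_of_real (char_poly A) = map_poly complex_of_real (\<Prod>e\<leftarrow>map Re as. [:- e, 1:])"
    using as unfolding of_real_hom.char_poly_hom[OF A] Re
    by (simp add: of_real.hom_prod_list o_def)
  then have "char_poly A = (\<Prod>e\<leftarrow>map Re as. [:- e, 1:])" by (rule of_real.injectivity)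
  then show ?thesis by blast
qed

text \<open>Because the polynomial splits, its real roots account for the whole degree and the list
  omits no eigenvalue. Sorting does not change the product, so comparing multisets suffices.\<close>

lemma char_poly_eigenvalue_list:
  assumes "A \<in> carrier_mat n n" and "A\<^sup>T = A"
  shows "char_poly A = (\<Prod>e\<leftarrow>eigenvalue_list A. [:- e, 1:])"
proof -
  obtain es where es: "char_poly A = (\<Prod>e\<leftarrow>es. [:- e, 1:])"
    using char_poly_symmetric_splits[OF assms] by blast
  have "proots (\<Prod>e\<leftarrow>es. [:- e, 1:]) = mset es"
  proof (induction es)
    case (Cons e es)
    have "(\<Prod>e\<leftarrow>es. [:- e, 1:]) \<noteq> 0" by (simp add: prod_list_zero_iff image_iff)
    then show ?case using Cons by (simp add: proots_mult del: mult_pCons_left)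
  qed simp
  then have "mset (eigenvalue_list A) = mset es" by (simp add: eigenvalue_list_def es)
  then have "mset (map (\<lambda>e. [:- e, 1:]) (eigenvalue_list A)) = mset (map (\<lambda>e. [:- e, 1:]) es)" by simp
  then show ?thesis unfolding es by (metis prod_mset_prod_list)
qed

text \<open>The vectors are the first \<open>k\<close> columns of the orthogonal matrix
  \<open>P\<close>: diagonal entry \<open>i\<close> of \<open>P\<^sup>T * A * P\<close> is the
  quadratic form of \<open>A\<close> at column \<open>i\<close>.\<close>

lemma sum_eigenvalue_list_eq:
  fixes A :: "real mat"
  assumes A: "A \<in> carrier_mat n n" and sym: "A\<^sup>T = A" and k: "k \<le> n"
  obtains x :: "nat \<Rightarrow> nat \<Rightarrow> real" where "orthonormal_on {..<n} {..<k} x"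
    and "(\<Sum>i<k. eigenvalue_list A ! i) = (\<Sum>i<k. \<Sum>a<n. \<Sum>b<n. A $$ (a, b) * x i a * x i b)"
proof -
  obtain P where P: "P \<in> carrier_mat n n" "P\<^sup>T * P = 1\<^sub>m n" "diag_mat (P\<^sup>T * A * P) = eigenvalue_list A"
    using orthogonal_schur_form[OF A char_poly_eigenvalue_list[OF A sym]] by blast
  define x where "x i a = P $$ (a, i)" for i a
  have "orthonormal_on {..<n} {..<k} x"
    unfolding orthonormal_on_def
  proof (intro ballI)
    fix i j assume "i \<in> {..<k}" "j \<in> {..<k}"
    then have ij: "i < n" "j < n" using k by auto
    then have "(P\<^sup>T * P) $$ (i, j) = (\<Sum>a<n. x i a * x j a)"
      using P(1) by (simp add: scalar_prod_def x_def atLeast0LessThan)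
    then show "(\<Sum>a<n. x i a * x j a) = (if i = j then 1 else 0)" using ij by (simp add: P(2))
  qed
  moreover have "eigenvalue_list A ! i = (\<Sum>a<n. \<Sum>b<n. A $$ (a, b) * x i a * x i b)" if "i < k" for i
  proof -
    have i: "i < n" using that k by simp
    have "eigenvalue_list A ! i = (P\<^sup>T * A * P) $$ (i, i)"
      using i P(1) by (simp add: diag_mat_def flip: P(3))
    also have "\<dots> = (\<Sum>a<n. \<Sum>b<n. A $$ (a, b) * x i a * x i b)"
      using i P(1) A by (simp add: scalar_prod_def x_def atLeast0LessThan sum_distrib_left mult_ac)
    finally show ?thesis .
  qed
  ultimately show ?thesis using that by simp
qed

section \<open>From the Laplacian matrix to the energy\<close>

text \<open>In the expanded square the two pure terms have equal sums, by reversing arcs, and form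
  the degree part; the mixed term is the adjacency part.\<close>

lemma energy_eq_laplacian_form:
  fixes x :: "'a \<Rightarrow> real"
  assumes V: "finite V" and E: "E \<subseteq> V \<times> V" "sym E"
  shows "energy E x = 2 * (\<Sum>a\<in>V. \<Sum>b\<in>V. ((if a = b then real (card (E `` {a})) else 0) - (if (a, b) \<in> E then 1 else 0)) * x a * x b)"
proof -
  have sumE: "(\<Sum>(a, b)\<in>E. f a b) = (\<Sum>a\<in>V. \<Sum>b\<in>V. if (a, b) \<in> E then f a b else 0)" for f :: "_ \<Rightarrow> _ \<Rightarrow> real"
  proof -
    have *: "(V \<times> V) \<inter> E = E" using E(1) by blast
    have "(\<Sum>(a, b)\<in>E. f a b) = (\<Sum>p\<in>(V \<times> V) \<inter> E. f (fst p) (snd p))" by (simp add: * case_prod_beta)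
    also have "\<dots> = (\<Sum>p\<in>V \<times> V. if p \<in> E then f (fst p) (snd p) else 0)"
      using V by (intro sum.inter_restrict) auto
    finally show ?thesis by (simp add: sum.cartesian_product case_prod_beta)
  qed
  have deg: "(\<Sum>b\<in>V. if (a, b) \<in> E then c else 0) = real (card (E `` {a})) * c" for a c
  proof -
    have "E `` {a} = {b \<in> V. (a, b) \<in> E}" using E(1) by auto
    then show ?thesis using V by (simp add: sum.inter_filter[symmetric])
  qed
  have "(\<Sum>(a, b)\<in>E. (x b)\<^sup>2) = (\<Sum>(a, b)\<in>E. (x a)\<^sup>2)"
    by (rule sum.reindex_bij_witness[of _ prod.swap prod.swap]) (use E(2) in \<open>auto dest: symD\<close>)
  then have "energy E x = 2 * ((\<Sum>(a, b)\<in>E. (x a)\<^sup>2) - (\<Sum>(a, b)\<in>E. x a * x b))"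
    by (simp add: energy_def power2_diff sum.distrib sum_subtractf case_prod_beta mult.assoc flip: sum_distrib_left)
  also have "(\<Sum>(a, b)\<in>E. (x a)\<^sup>2) = (\<Sum>a\<in>V. \<Sum>b\<in>V. (if a = b then real (card (E `` {a})) else 0) * x a * x b)"
    unfolding sumE deg
  proof (rule sum.cong[OF refl])
    fix a assume a: "a \<in> V"
    have "(\<Sum>b\<in>V. (if a = b then real (card (E `` {a})) else 0) * x a * x b)
        = (\<Sum>b\<in>V. if a = b then real (card (E `` {a})) * x a * x a else 0)" by (intro sum.cong) auto
    then show "real (card (E `` {a})) * (x a)\<^sup>2 = (\<Sum>b\<in>V. (if a = b then real (card (E `` {a})) else 0) * x a * x b)"
      using V a by (simp add: power2_eq_square)
  qed
  also have "(\<Sum>(a, b)\<in>E. x a * x b) = (\<Sum>a\<in>V. \<Sum>b\<in>V. (if (a, b) \<in> E then 1 else 0) * x a * x b)"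
    unfolding sumE by (intro sum.cong) auto
  finally show ?thesis by (simp add: left_diff_distrib sum_subtractf)
qed

text \<open>The matrix is indexed by positions in \<open>vs\<close>, the energy by vertices; columns
  are carried over along the inverse of \<open>(!) vs\<close>.\<close>

lemma (in graph) laplacian_sum_eq_energy:
  assumes vs: "distinct vs" "set vs = verts G" and k: "k \<le> card (verts G)"
  obtains u :: "nat \<Rightarrow> 'a \<Rightarrow> real" where "orthonormal_on (verts G) {..<k} u"
    and "laplacian_sum G vs k = (\<Sum>i<k. energy (arcs_ends G) (u i)) / 2"
proof -
  define n where "n = length vs"
  have n: "n = card (verts G)" using distinct_card[OF vs(1)] vs(2) by (simp add: n_def)
  define E where "E = arcs_ends G"
  have E: "E \<subseteq> verts G \<times> verts G" "sym E"
    using sym_arcs by (auto simp: E_def arcs_ends_conv symmetric_def)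
  \<comment> \<open>The out-degree counts arcs; without parallel arcs these correspond to
    neighbours.\<close>
  have deg: "out_degree G v = card (E `` {v})" for v
  proof -
    have "E `` {v} = head G ` out_arcs G v" by (auto simp: E_def arcs_ends_conv image_iff)
    moreover have "inj_on (head G) (out_arcs G v)"
      by (rule inj_onI) (auto intro: no_multi_arcs simp: arc_to_ends_def)
    ultimately show ?thesis by (simp add: out_degree_def card_image)
  qed
  define A where "A = laplacian_matrix G vs"
  have A: "A \<in> carrier_mat n n"
    unfolding A_def laplacian_matrix_def adjacency_matrix_def n_def by (intro minus_carrier_mat mat_carrier)
  have Aij: "A $$ (i, j) = (if vs ! i = vs ! j then real (card (E `` {vs ! i})) else 0) - (if (vs ! i, vs ! j) \<in> E then 1 else 0)"
    if "i < n" "j < n" for i j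
    using that nth_eq_iff_index_eq[OF vs(1), of i j]
    by (simp add: A_def laplacian_matrix_def degree_matrix_def adjacency_matrix_def n_def deg flip: E_def)
  have sym: "A\<^sup>T = A"
  proof (rule eq_matI)
    fix i j assume "i < dim_row A" "j < dim_col A"
    then have ij: "i < n" "j < n" using A by auto
    have "(vs ! i, vs ! j) \<in> E \<longleftrightarrow> (vs ! j, vs ! i) \<in> E" using E(2) by (meson symE)
    then have "A $$ (j, i) = A $$ (i, j)" by (cases "vs ! i = vs ! j") (simp_all add: Aij ij)
    then show "A\<^sup>T $$ (i, j) = A $$ (i, j)" using ij A by simp
  qed (use A in auto)
  have "k \<le> n" using k n by simp
  obtain x where x: "orthonormal_on {..<n} {..<k} x"
    "(\<Sum>i<k. eigenvalue_list A ! i) = (\<Sum>i<k. \<Sum>a<n. \<Sum>b<n. A $$ (a, b) * x i a * x i b)"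
    by (rule sum_eigenvalue_list_eq[OF A sym \<open>k \<le> n\<close>])
  have bij: "bij_betw ((!) vs) {..<n} (verts G)"
    using bij_betw_nth[OF vs(1)] vs(2) by (simp add: n_def)
  define idx where "idx = the_inv_into {..<n} ((!) vs)"
  have idx: "idx (vs ! a) = a" if "a < n" for a
    using that bij by (auto simp: idx_def bij_betw_def intro: the_inv_into_f_f)
  define u where "u i v = x i (idx v)" for i v
  have re: "sum f (verts G) = (\<Sum>a<n. f (vs ! a))" for f :: "'a \<Rightarrow> real"
    by (rule sum.reindex_bij_betw[OF bij, symmetric])
  have "orthonormal_on (verts G) {..<k} u"
    using x(1) by (simp add: orthonormal_on_def re u_def idx)
  moreover have "energy E (u i) = 2 * (\<Sum>a<n. \<Sum>b<n. A $$ (a, b) * x i a * x i b)" for i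
    unfolding energy_eq_laplacian_form[OF finite_verts E] re
    by (intro arg_cong[of _ _ "(*) 2"] sum.cong refl) (simp add: Aij u_def idx)
  then have "laplacian_sum G vs k = (\<Sum>i<k. energy (arcs_ends G) (u i)) / 2"
    by (simp add: laplacian_sum_def x(2) flip: A_def E_def sum_distrib_left)
  ultimately show ?thesis using that by blast
qed

section \<open>Counting arcs through components\<close>

text \<open>\<open>D S\<close> is the fibre of ordered pairs over the unordered pair
  \<open>S\<close>, which has at most two elements.\<close>

lemma card_arcs_ends_le:
  fixes G :: "('a, 'b) pre_digraph"
  assumes "finite (arcs G)"
  shows "card (arcs_ends G) \<le> 2 * num_edges G"
proof -
  define D where "D S = {(a, b). {a, b} = (S :: 'a set)}" for S
  let ?Es = "(\<lambda>e. {tail G e, head G e}) ` arcs G"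
  have fib: "D {a, b} = {(a, b), (b, a)}" for a b by (auto simp: D_def doubleton_eq_iff)
  have D: "finite (D S)" "card (D S) \<le> 2" if S: "S \<in> ?Es" for S
  proof -
    obtain a b where "S = {a, b}" using S by blast
    then have "D S = {(a, b), (b, a)}" by (simp only: fib)
    then show "finite (D S)" "card (D S) \<le> 2" using card_insert_le_m1[of 2 "{(b, a)}" "(a, b)"] by simp_all
  qed
  have "arcs_ends G \<subseteq> (\<Union>S\<in>?Es. D S)"
    unfolding arcs_ends_conv by (intro image_subsetI UN_I imageI) (simp_all add: D_def)
  then have "card (arcs_ends G) \<le> card (\<Union>S\<in>?Es. D S)"
    using assms D(1) by (intro card_mono finite_UN_I finite_imageI)
  also have "\<dots> \<le> (\<Sum>S\<in>?Es. card (D S))" using assms by (intro card_UN_le) auto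
  also have "\<dots> \<le> (\<Sum>S\<in>?Es. 2)" by (intro sum_mono D(2))
  finally show ?thesis by (simp add: num_edges_def)
qed

section \<open>Components: vertices and arcs\<close>

lemma (in graph) finite_sccs: "finite sccs"
  using finite_sccs_verts inj_on_verts_sccs unfolding sccs_verts_conv by (rule finite_imageD)

lemma (in graph) scc_verts:
  assumes "C \<in> sccs"
  shows "verts C \<subseteq> verts G" "verts C \<noteq> {}" "finite (verts C)"
proof -
  show 1: "verts C \<subseteq> verts G" using assms by (auto dest: in_sccs_imp_induced)
  show "verts C \<noteq> {}" using assms by (auto simp: sccs_def strongly_connected_def)
  show "finite (verts C)" using 1 by (rule finite_subset) simp
qed

lemma (in graph) card_UN_sccs:
  assumes "S \<subseteq> sccs"
  shows "card (\<Union>C\<in>S. verts C) = (\<Sum>C\<in>S. card (verts C))"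
proof (intro card_UN_disjoint ballI impI)
  show "finite S" using assms finite_sccs by (rule finite_subset)
  show "finite (verts C)" if "C \<in> S" for C using that assms scc_verts(3) by blast
  show "verts C \<inter> verts D = {}" if "C \<in> S" "D \<in> S" "C \<noteq> D" for C D
    using that assms by (intro scc_disj) auto
qed

lemma (in graph) sccs_nontrivial_Un_trivial: "sccs = nontrivial_components G \<union> trivial_components G"
proof -
  have "0 < card (verts C)" if "C \<in> sccs" for C using scc_verts[OF that] by (simp add: card_gt_0_iff)
  then have "card (verts C) = 1 \<or> 2 \<le> card (verts C)" if "C \<in> sccs" for C using that by force
  then show ?thesis by (auto simp: nontrivial_components_def trivial_components_def)
qed

lemma (in graph) sum_card_nontrivial_components:
  "(\<Sum>C\<in>nontrivial_components G. card (verts C)) + card (trivial_components G) = card (verts G)"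
proof -
  have fin: "finite (nontrivial_components G)" "finite (trivial_components G)"
    using finite_sccs unfolding sccs_nontrivial_Un_trivial by auto
  have "(\<Union>C\<in>sccs. verts C) = verts G"
    using graph_is_union_sccs by (metis Union_def pre_digraph.select_convs(1))
  then have "card (verts G) = (\<Sum>C\<in>sccs. card (verts C))" using card_UN_sccs[of sccs] by simp
  also have "\<dots> = (\<Sum>C\<in>nontrivial_components G. card (verts C)) + (\<Sum>C\<in>trivial_components G. card (verts C))"
    unfolding sccs_nontrivial_Un_trivial using fin
    by (intro sum.union_disjoint) (auto simp: nontrivial_components_def trivial_components_def)
  also have "(\<Sum>C\<in>trivial_components G. card (verts C)) = card (trivial_components G)"
    by (simp add: trivial_components_def)
  finally show ?thesis by simp
qed

text \<open>A walk from \<open>v\<close> to another vertex of its component has to leave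
  \<open>v\<close> along an arc.\<close>

lemma (in graph) nontrivial_components_subset_Domain:
  assumes "C \<in> nontrivial_components G"
  shows "verts C \<subseteq> Domain (arcs_ends G)"
proof
  fix v assume v: "v \<in> verts C"
  have C: "C \<in> sccs" "2 \<le> card (verts C)" using assms by (auto simp: nontrivial_components_def)
  have "verts C \<noteq> {v}" using C(2) by auto
  then obtain w where w: "w \<in> verts C" "w \<noteq> v" using v by blast
  have "v \<rightarrow>\<^sup>*\<^bsub>C\<^esub> w" using C(1) v w by (auto simp: sccs_def strongly_connected_def)
  moreover have "subgraph C G" using C(1) by (auto dest: in_sccs_imp_induced)
  ultimately have "v \<rightarrow>\<^sup>* w" by (rule reachable_mono)
  then show "v \<in> Domain (arcs_ends G)"
    by (cases rule: converse_reachable_cases) (use w in auto)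
qed

text \<open>By symmetry every arc lies inside one strongly connected component, and its two distinct
  ends make that component non-trivial.\<close>

lemma (in graph) arcs_ends_subset_UN_nontrivial_components:
  "arcs_ends G \<subseteq> (\<Union>C\<in>nontrivial_components G. arcs_ends C)"
proof
  fix x assume "x \<in> arcs_ends G"
  then obtain e where e: "e \<in> arcs G" "x = (tail G e, head G e)" by (auto simp: arcs_ends_conv)
  have "(\<Union>C\<in>sccs. arcs C) = arcs G"
    using graph_is_union_sccs by (metis Union_def pre_digraph.select_convs(2))
  then obtain C where C: "C \<in> sccs" "e \<in> arcs C" using e by blast
  then have sub: "subgraph C G" by (auto dest: in_sccs_imp_induced)
  then have ends: "tail C = tail G" "head C = head G" and wf: "wf_digraph C"
    by (auto simp: subgraph_def compatible_def)
  have "{tail G e, head G e} \<subseteq> verts C" using wf C(2) by (auto simp flip: ends intro: wf_digraph.wellformed)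
  then have "card {tail G e, head G e} \<le> card (verts C)" using scc_verts[OF C(1)] by (intro card_mono)
  then have "C \<in> nontrivial_components G"
    using no_loops[OF e(1)] C(1) by (simp add: nontrivial_components_def)
  moreover have "x \<in> arcs_ends C" using C(2) e by (auto simp: arcs_ends_conv ends)
  ultimately show "x \<in> (\<Union>C\<in>nontrivial_components G. arcs_ends C)" by blast
qed

text \<open>A lower bound on the number of non-isolated vertices, which enters the energy bound with
  a negative sign.\<close>

lemma (in graph) card_verts_le_card_Domain:
  "card (verts G) \<le> card (Domain (arcs_ends G)) + card (trivial_components G)"
proof -
  have "(\<Sum>C\<in>nontrivial_components G. card (verts C)) = card (\<Union>C\<in>nontrivial_components G. verts C)"
    by (intro card_UN_sccs[symmetric]) (auto simp: nontrivial_components_def)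
  also have "\<dots> \<le> card (Domain (arcs_ends G))"
    using nontrivial_components_subset_Domain
    by (intro card_mono) (auto intro: finite_Domain simp: arcs_ends_conv)
  finally show ?thesis using sum_card_nontrivial_components by simp
qed

text \<open>Each non-trivial component has \<open>c - 1\<close> more edges than vertices, and at
  most two arcs for each edge; the orders of these components add up to all vertices outside the
  trivial ones.\<close>

lemma (in graph) card_arcs_ends_le_c_cyclic:
  assumes "\<forall>C\<in>nontrivial_components G. c_cyclic c C"
  shows "real (card (arcs_ends G)) \<le> 2 * (real (card (verts G)) - real (card (trivial_components G))
    + real (card (nontrivial_components G)) * (real c - 1))"
proof -
  have fin: "finite (nontrivial_components G)"
    using finite_sccs unfolding sccs_nontrivial_Un_trivial by auto
  have graphC: "finite (arcs C)" if "C \<in> nontrivial_components G" for C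
    using assms that by (auto simp: c_cyclic_def graph_def digraph_def intro: fin_digraph.finite_arcs)
  have "card (arcs_ends G) \<le> card (\<Union>C\<in>nontrivial_components G. arcs_ends C)"
    using fin graphC arcs_ends_subset_UN_nontrivial_components
    by (intro card_mono) (auto simp: arcs_ends_conv)
  also have "\<dots> \<le> (\<Sum>C\<in>nontrivial_components G. card (arcs_ends C))" using fin by (rule card_UN_le)
  also have "\<dots> \<le> (\<Sum>C\<in>nontrivial_components G. 2 * num_edges C)"
    using graphC by (intro sum_mono card_arcs_ends_le)
  finally have "real (card (arcs_ends G)) \<le> (\<Sum>C\<in>nontrivial_components G. 2 * real (num_edges C))"
    by (metis (no_types, lifting) of_nat_le_iff of_nat_mult of_nat_numeral of_nat_sum sum.cong)
  also have "\<dots> = (\<Sum>C\<in>nontrivial_components G. 2 * (real (card (verts C)) + (real c - 1)))"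
  proof (intro sum.cong refl)
    fix C assume "C \<in> nontrivial_components G"
    then have "int (num_edges C) = int (card (verts C)) + int c - 1" using assms by (simp add: c_cyclic_def)
    \<comment> \<open>The equation passes from integers to reals, since \<open>c - 1\<close> would
      be truncated over the naturals when \<open>c = 0\<close>, the case of trees.\<close>
    then have "real_of_int (int (num_edges C)) = real_of_int (int (card (verts C)) + int c - 1)" by simp
    then show "2 * real (num_edges C) = 2 * (real (card (verts C)) + (real c - 1))" by simp
  qed
  also have "\<dots> = 2 * (real (\<Sum>C\<in>nontrivial_components G. card (verts C))
      + real (card (nontrivial_components G)) * (real c - 1))"
    by (simp add: sum.distrib flip: sum_distrib_left)
  also have "real (\<Sum>C\<in>nontrivial_components G. card (verts C))
      = real (card (verts G)) - real (card (trivial_components G))"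
    using sum_card_nontrivial_components by linarith
  finally show ?thesis .
qed

section \<open>The bound\<close>

text \<open>Without parallel arcs \<open>arc_to_ends\<close> is injective, so deleting the arcs of
  \<open>K\<close> removes exactly their end pairs; a difference of symmetric relations is again
  symmetric.\<close>

lemma graph_delete_edges:
  assumes G: "graph G" and K: "graph K" "subgraph K G"
  shows "graph (delete_edges G K)" and "arcs_ends (delete_edges G K) = arcs_ends G - arcs_ends K"
proof -
  interpret G: graph G by (rule G)
  interpret K: graph K by (rule K(1))
  have KG: "arcs K \<subseteq> arcs G" "tail K = tail G" "head K = head G"
    using K(2) by (auto simp: subgraph_def compatible_def)
  show ends: "arcs_ends (delete_edges G K) = arcs_ends G - arcs_ends K"
    using KG inj_on_image_set_diff[OF G.inj_on_arc_to_ends, of "arcs G" "arcs K"]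
    by (simp add: arcs_ends_def delete_edges_def arc_to_ends_def[abs_def])
  have "subgraph (delete_edges G K) G"
    by (intro subgraphI G.wf_digraph) (auto simp: delete_edges_def compatible_def intro!: wf_digraph.intro)
  then have "digraph (delete_edges G K)" by (rule G.digraph_subgraph)
  moreover have "symmetric (delete_edges G K)"
    using G.sym_arcs K.sym_arcs unfolding symmetric_def ends by (auto simp: sym_def)
  ultimately show "graph (delete_edges G K)" by (rule digraph.graphI)
qed

lemma (in graph) irrefl_arcs_ends: "irrefl (arcs_ends G)"
  using adj_not_same by (auto simp: irrefl_def)

theorem theorem2p3:
  fixes G K H :: "('a, 'b) pre_digraph"
    and vs :: "'a list"
    and n m s1 s2 r p c k :: nat
  assumes "graph G"
    and "Digraph_Component.connected G"
    and "card (verts G) = n" and "n \<ge> 4"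
    and "num_edges G = m"
    and "distinct vs" and "set vs = verts G"
    and "s1 \<ge> s2" and "s2 \<ge> 2"
    and "maximal_complete_bipartite s1 s2 K G"
    and "H = delete_edges G K"
    and "card (nontrivial_components H) = r"
    and "\<forall>C \<in> nontrivial_components H. c_cyclic c C"
    and "card (trivial_components H) = p"
    and "1 \<le> k" and "k \<le> n"
  shows "(k \<ge> s1 + s2 - 1 \<longrightarrow>
            laplacian_sum G vs k
              \<le> 2 * real s1 * real s2 + real n - real p + 2 * real r * (real c - 1) + 2 * real k)
       \<and> (k \<le> s1 + s2 - 2 \<longrightarrow>
            laplacian_sum G vs k
              \<le> real s2 + real k * real s1 + real n - real p + 2 * real r * (real c - 1) + 2 * real k)"
proof -
  interpret G: graph G by (rule assms(1))
  have K: "complete_bipartite_digraph s1 s2 K" "subgraph K G"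
    using assms(10) by (auto simp: maximal_complete_bipartite_def pre_digraph.max_subgraph_def)
  then interpret K: graph K by (simp add: complete_bipartite_digraph_def)
  obtain U W where UW: "verts K = U \<union> W" "U \<inter> W = {}" "card U = s1" "card W = s2"
    "arcs_ends K = U \<times> W \<union> W \<times> U"
    using K(1) unfolding complete_bipartite_digraph_def by blast
  have UWG: "U \<subseteq> verts G" "W \<subseteq> verts G" using K(2) UW(1) by (auto simp: subgraph_def)
  interpret H: graph H
    unfolding assms(11) by (rule graph_delete_edges(1)[OF assms(1) K.graph_axioms K(2)])
  have EH: "arcs_ends H = arcs_ends G - arcs_ends K"
    unfolding assms(11) by (rule graph_delete_edges(2)[OF assms(1) K.graph_axioms K(2)])
  have vH: "verts H = verts G" by (simp add: assms(11) delete_edges_def)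
  have KG: "arcs_ends K \<subseteq> arcs_ends G" using K(2) by (rule arcs_ends_mono)
  have finG: "finite (arcs_ends G)" by (simp add: arcs_ends_def)
  obtain u :: "nat \<Rightarrow> 'a \<Rightarrow> real" where u: "orthonormal_on (verts G) {..<k} u"
    and sum: "laplacian_sum G vs k = (\<Sum>i<k. energy (arcs_ends G) (u i)) / 2"
    using G.laplacian_sum_eq_energy[OF assms(6,7)] assms(3,16) by metis
  \<comment> \<open>The arcs of \<open>G\<close> are the disjoint union of those of \<open>K\<close>
    and \<open>H\<close>, so one family \<open>u\<close> can be estimated on both
    separately.\<close>
  have "energy (arcs_ends G) x = energy (arcs_ends K) x + energy (arcs_ends H) x" for x :: "'a \<Rightarrow> real"
    unfolding energy_def EH using sum.subset_diff[OF KG finG] by (simp add: add.commute)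
  then have split: "laplacian_sum G vs k
      = (\<Sum>i<k. energy (arcs_ends K) (u i)) / 2 + (\<Sum>i<k. energy (arcs_ends H) (u i)) / 2"
    by (simp add: sum sum.distrib add_divide_distrib)
  have "arcs_ends H \<subseteq> verts G \<times> verts G" using H.adj_in_verts by (auto simp flip: vH)
  then have "(\<Sum>i<k. energy (arcs_ends H) (u i))
      \<le> 2 * (real (card (arcs_ends H)) - real (card (Domain (arcs_ends H))) + 2 * real k)"
    using sum_energy_le_card_Domain[OF _ G.finite_verts u _ _ H.irrefl_arcs_ends] H.sym_arcs
    by (simp add: symmetric_def)
  moreover have "real (card (arcs_ends H)) \<le> 2 * (real n - real p + real r * (real c - 1))"
    using H.card_arcs_ends_le_c_cyclic[OF assms(13)] by (simp add: vH assms(3,12,14))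
  moreover have "n \<le> card (Domain (arcs_ends H)) + p"
    using H.card_verts_le_card_Domain by (simp add: vH assms(3,14))
  \<comment> \<open>This is half of \<open>2 (2 (n - p + r (c - 1)) - (n - p) + 2 k)\<close>, from
    the upper bound on arcs and the lower bound \<open>n - p\<close> on non-isolated
    vertices.\<close>
  ultimately have H: "(\<Sum>i<k. energy (arcs_ends H) (u i)) / 2
      \<le> real n - real p + 2 * real r * (real c - 1) + 2 * real k"
    by (simp add: algebra_simps)
  have "card (arcs_ends K) \<le> s1 * s2 + s2 * s1"
    using card_Un_le[of "U \<times> W" "W \<times> U"] by (simp add: UW card_cartesian_product)
  then have "real (card (arcs_ends K)) \<le> real (s1 * s2 + s2 * s1)" by (simp only: of_nat_le_iff)
  moreover have "(\<Sum>i<k. energy (arcs_ends K) (u i)) \<le> 2 * real (card (arcs_ends K))"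
    using UWG by (intro sum_energy_le[OF _ G.finite_verts u _ K.irrefl_arcs_ends]) (auto simp: UW)
  ultimately have K1: "(\<Sum>i<k. energy (arcs_ends K) (u i)) / 2 \<le> 2 * real s1 * real s2" by simp
  have "W \<noteq> {}" using UW(4) assms(9) by auto
  then have K2: "(\<Sum>i<k. energy (arcs_ends K) (u i)) / 2 \<le> real s2 + real k * real s1"
    using sum_energy_complete_bipartite_le[OF _ G.finite_verts u UWG UW(2)] assms(8) by (simp add: UW)
  \<comment> \<open>The first case adds \<open>K1\<close> to the bound for \<open>H\<close>, the
    second adds \<open>K2\<close>.\<close>
  show ?thesis unfolding split using H K1 K2 by auto
qed

end
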